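(* Let $g\in L^2(\mathbb{R})$ with $\|g\|_2=1$. Let $a,b\in\mathbb{R}$ with $b\ne 0$ and let $\Lambda = \{(0,0),(0,1),(0,-1),(a,b),(a,-b)\}$. Then $\mathcal{G}(g,\Lambda) = \{g,\ M_1 g,\ M_{-1}g,\ M_bT_a g,\ M_{-b}T_a g\}$ is linearly independent in $L^2(\mathbb{R})$ whenever any of the following holds: (i) $a,b\in\mathbb{Q}$; (ii) $a\in\mathbb{Q}$ and $b\notin\mathbb{Q}$; (iii) $a,b\notin\mathbb{Q}$, $ab\in\mathbb{Q}$, and $g$ is real-valued.
   Context: $M_b f(x) = e^{2\pi i b x} f(x)$ and $T_a f(x) = f(x-a)$. *)

theory Defs
  imports "HOL-Analysis.Analysis"
begin

definition modulation :: "real \<Rightarrow> (real \<Rightarrow> complex) \<Rightarrow> real \<Rightarrow> complex" ("M") where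
  "M b f = (\<lambda>x. exp (2 * of_real pi * \<i> * of_real b * of_real x) * f x)"

definition translation :: "real \<Rightarrow> (real \<Rightarrow> complex) \<Rightarrow> real \<Rightarrow> complex" ("T") where
  "T a f = (\<lambda>x. f (x - a))"

definition L2 :: "(real \<Rightarrow> complex) \<Rightarrow> bool" where
  "L2 f \<longleftrightarrow> f \<in> borel_measurable lborel \<and> integrable lborel (\<lambda>x. (cmod (f x))\<^sup>2)"

definition L2_norm :: "(real \<Rightarrow> complex) \<Rightarrow> real" where
  "L2_norm f = sqrt (LINT x|lborel. (cmod (f x))\<^sup>2)"

definition gabor_atom :: "(real \<Rightarrow> complex) \<Rightarrow> real \<times> real \<Rightarrow> real \<Rightarrow> complex" where
  "gabor_atom g p = M (snd p) (T (fst p) g)"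

text \<open>Linear independence (over \<open>\<complex>\<close>) in \<open>L\<^sup>2(\<real>)\<close> of the family indexed by the
  finite set \<open>\<Lambda>\<close>: equality in \<open>L\<^sup>2\<close> is equality almost everywhere.\<close>
definition gabor_lin_indep :: "(real \<Rightarrow> complex) \<Rightarrow> (real \<times> real) set \<Rightarrow> bool" where
  "gabor_lin_indep g \<Lambda> \<longleftrightarrow>
     (\<forall>c :: real \<times> real \<Rightarrow> complex.
        (AE x in lborel. (\<Sum>p\<in>\<Lambda>. c p * gabor_atom g p x) = 0) \<longrightarrow> (\<forall>p\<in>\<Lambda>. c p = 0))"

end

(* A nontrivial dependence reads P(x) g(x) = Q(x) g(x - a) with P, Q trigonometric polynomials of
   periods 1 and 1/b; both are nonzero almost everywhere, as their zeros are countable. If a (resp. ab)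
   is rational, a step s = n a is a period of P (resp. Q), and iteration gives, for f = |g|,
   u(x) f(x + s) = w(x) f(x) with u of period s and w of some period t.
   Square integrability makes f tend to 0 along almost every orbit x + sZ, so on such an orbit, if
   f(x) is nonzero, f attains its maximum, and x can be moved to the last point where it does. Call
   these points peaks; it remains to show that their set is null. The sequence
   H_x(n) = f(x + ns) u(x)^n / f(x) depends only on x modulo t. Hence for peaks with the same value of
   u, no two distinct translates by multiples of s agree modulo t, and such a set is null because the
   translates reduced modulo t would be infinitely many disjoint copies in a bounded interval. If two
   peaks x, y agree modulo s and t but u(x) < r < u(y) with r rational, then H / r^n also tends to 0
   at both ends, so the orbit meets the last-maximum set of H / r^n; for each of the countably many r
   this set is null by the same wandering argument. *)

theory Submission
  imports Defs
begin

subsection \<open>Zeros of exponential sums\<close>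

text \<open>An isolated point is the only point of \<open>S\<close> in some interval with rational
  endpoints, and that interval determines it.\<close>

lemma countable_isolated_points:
  fixes S :: "real set"
  shows "countable {x \<in> S. \<not> x islimpt S}"
proof -
  let ?I = "{x \<in> S. \<not> x islimpt S}"
  have "\<forall>x\<in>?I. \<exists>p :: rat \<times> rat. S \<inter> {of_rat (fst p)<..<of_rat (snd p)} = {x}"
  proof
    fix x assume "x \<in> ?I"
    then have xS: "x \<in> S" and "\<not> x islimpt S" by simp_all
    then obtain e where e: "e > 0" "\<forall>y\<in>S. y \<noteq> x \<longrightarrow> \<not> dist y x < e"
      unfolding islimpt_approachable by blast
    have "x - e < x" "x < x + e" using e(1) by simp_all
    then obtain r q where r: "x - e < of_rat r" "of_rat r < x" and q: "x < of_rat q" "of_rat q < x + e"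
      using of_rat_dense by meson
    have only: "y = x" if "y \<in> S" "of_rat r < y" "y < of_rat q" for y
    proof (rule ccontr)
      assume "y \<noteq> x"
      then have "\<not> \<bar>y - x\<bar> < e" using e(2) that(1) by (simp add: dist_real_def)
      moreover have "\<bar>y - x\<bar> < e" if "u < y" "y < v" "x - e < u" "v < x + e" for u v :: real
        using that by linarith
      ultimately show False using that(2,3) r(1) q(2) by blast
    qed
    have "S \<inter> {of_rat r<..<of_rat q} = {x}"
      using xS r(2) q(1) by (auto dest: only)
    then show "\<exists>p :: rat \<times> rat. S \<inter> {of_rat (fst p)<..<of_rat (snd p)} = {x}"
      by (intro exI[of _ "(r, q)"]) simp
  qed
  then obtain p :: "real \<Rightarrow> rat \<times> rat"
    where p: "\<forall>x\<in>?I. S \<inter> {of_rat (fst (p x))<..<of_rat (snd (p x))} = {x}"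
    by (rule bchoice[THEN exE])
  have "inj_on p ?I"
  proof (rule inj_onI)
    fix x y assume xy: "x \<in> ?I" "y \<in> ?I" "p x = p y"
    have "{x} = {y}" using bspec[OF p xy(1)] bspec[OF p xy(2)] unfolding xy(3) by (rule trans[OF sym])
    then show "x = y" by simp
  qed
  then show ?thesis by (rule countableI')
qed

text \<open>Along the zeros accumulating at \<open>x\<close> the difference quotients of
  \<open>h\<close> vanish.\<close>

lemma has_vector_derivative_zero_islimpt:
  fixes h :: "real \<Rightarrow> complex"
  assumes h: "(h has_vector_derivative d) (at x)" and x: "x islimpt {y. h y = 0}" and hx: "h x = 0"
  shows "d = 0"
proof (rule ccontr)
  assume "d \<noteq> 0"
  have "((\<lambda>y. norm (h y - h x - (y - x) *\<^sub>R d) / norm (y - x)) \<longlongrightarrow> 0) (at x)"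
    using h by (simp add: has_vector_derivative_def has_derivative_iff_norm)
  then have "\<forall>\<^sub>F y in at x. norm (h y - h x - (y - x) *\<^sub>R d) / norm (y - x) < norm d"
    by (rule order_tendstoD) (use \<open>d \<noteq> 0\<close> in simp)
  moreover have "\<forall>\<^sub>F y in at x. y \<noteq> x" by (simp add: eventually_neq_at_within)
  \<comment> \<open>At a zero \<open>y\<close> of \<open>h\<close> other than \<open>x\<close> the
    quotient is exactly \<open>norm d\<close>, not less.\<close>
  ultimately have "\<forall>\<^sub>F y in at x. h y \<noteq> 0" by eventually_elim (auto simp: hx)
  then show False using x by (auto simp: islimpt_iff_eventually)
qed

(* Dividing by one exponential and differentiating removes a term; a zero is either isolated
   (countably many) or a limit of zeros, hence a zero of the derivative. *)
lemma countable_zeros_exp_sum: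
  fixes c :: "real \<Rightarrow> complex"
  assumes "finite L" "L \<noteq> {}" "\<And>l. l \<in> L \<Longrightarrow> c l \<noteq> 0"
  shows "countable {x::real. (\<Sum>l\<in>L. c l * exp (2 * of_real pi * \<i> * of_real l * of_real x)) = 0}"
  using assms
proof (induction "card L" arbitrary: L c)
  case 0
  then show ?case by simp
next
  case (Suc n)
  define e :: "real \<Rightarrow> real \<Rightarrow> complex" where "e = (\<lambda>l x. exp (2 * of_real pi * \<i> * of_real l * of_real x))"
  have e_add: "e (l + m) x = e l x * e m x" for l m x
    by (simp add: e_def exp_add [symmetric] algebra_simps)
  have e_nz: "e l x \<noteq> 0" for l x by (simp add: e_def)
  have e_0: "e 0 x = 1" for x by (simp add: e_def)
  obtain m where m: "m \<in> L" using Suc by blast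
  define K where "K = (\<lambda>l. l - m) ` (L - {m})"
  define h where "h x = (\<Sum>l\<in>L. c l * e (l - m) x)" for x
  define d where "d k = c (k + m) * (2 * of_real pi * \<i> * of_real k)" for k
  define h' where "h' x = (\<Sum>k\<in>K. d k * e k x)" for x
  have h_zero: "(\<Sum>l\<in>L. c l * e l x) = 0 \<longleftrightarrow> h x = 0" for x
  proof -
    have "(\<Sum>l\<in>L. c l * e l x) = h x * e m x"
      unfolding h_def sum_distrib_right by (intro sum.cong) (simp_all add: mult.assoc flip: e_add)
    then show ?thesis using e_nz by simp
  qed
  have h'_eq: "h' x = (\<Sum>l\<in>L. c l * ((2 * of_real pi * \<i> * of_real (l - m)) * e (l - m) x))" for x
  proof -
    have "h' x = (\<Sum>l\<in>L - {m}. c l * ((2 * of_real pi * \<i> * of_real (l - m)) * e (l - m) x))"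
      unfolding h'_def K_def d_def by (subst sum.reindex) (auto simp: inj_on_def mult.assoc)
    also have "\<dots> = (\<Sum>l\<in>L. c l * ((2 * of_real pi * \<i> * of_real (l - m)) * e (l - m) x))"
      \<comment> \<open>The restored term \<open>l = m\<close> has the factor
        \<open>l - m = 0\<close>.\<close>
      by (rule sum.mono_neutral_left) (use Suc in auto)
    finally show ?thesis .
  qed
  have deriv_e: "(e k has_vector_derivative (2 * of_real pi * \<i> * of_real k) * e k x) (at x)" for k x
    unfolding e_def
    by (rule has_vector_derivative_real_field[of "\<lambda>z. exp (2 * of_real pi * \<i> * of_real k * z)"])
      (auto intro!: derivative_eq_intros)
  have deriv: "(h has_vector_derivative h' x) (at x)" for x
    unfolding h_def h'_eq
    by (intro has_vector_derivative_sum has_vector_derivative_mult_right deriv_e)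
  show ?case
  proof (cases "K = {}")
    case True
    then have "L = {m}" using m by (auto simp: K_def)
    then have "h x \<noteq> 0" for x using Suc.prems m by (simp add: h_def e_0)
    then show ?thesis using h_zero unfolding e_def by simp
  next
    case False
    have "card K = n" using Suc.hyps(2) Suc.prems(1) m unfolding K_def
      by (subst card_image) (auto simp: inj_on_def)
    moreover have "d k \<noteq> 0" if "k \<in> K" for k
      using that Suc.prems by (auto simp: K_def d_def)
    ultimately have "countable {x. h' x = 0}"
      using Suc.hyps(1)[of K d] False Suc.prems(1) unfolding h'_def e_def by (auto simp: K_def)
    moreover have "{x. h x = 0} \<subseteq> {x \<in> {y. h y = 0}. \<not> x islimpt {y. h y = 0}} \<union> {x. h' x = 0}"
      using has_vector_derivative_zero_islimpt[OF deriv] by auto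
    ultimately have "countable {x. h x = 0}"
      using countable_isolated_points[of "{y. h y = 0}"] by (meson countable_Un countable_subset)
    then show ?thesis using h_zero unfolding e_def by simp
  qed
qed

text \<open>Dropping the zero coefficients leaves a nonempty sum with countably many zeros. A single
  nonzero coefficient is what a nontrivial dependence provides.\<close>

lemma AE_exp_sum_nonzero:
  fixes c :: "real \<Rightarrow> complex"
  assumes "finite L" "l \<in> L" "c l \<noteq> 0"
  shows "AE x::real in lborel. (\<Sum>l\<in>L. c l * exp (2 * of_real pi * \<i> * of_real l * of_real x)) \<noteq> 0"
proof -
  define L' where "L' = {l\<in>L. c l \<noteq> 0}"
  have "(\<Sum>l\<in>L. c l * exp (2 * of_real pi * \<i> * of_real l * of_real x))
      = (\<Sum>l\<in>L'. c l * exp (2 * of_real pi * \<i> * of_real l * of_real x))" for x :: real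
    unfolding L'_def by (rule sum.mono_neutral_right) (use assms in auto)
  moreover have "countable {x::real. (\<Sum>l\<in>L'. c l * exp (2 * of_real pi * \<i> * of_real l * of_real x)) = 0}"
    by (rule countable_zeros_exp_sum) (use assms in \<open>auto simp: L'_def\<close>)
  ultimately show ?thesis
    by (intro AE_I'[OF countable_imp_null_set_lborel]) auto
qed

subsection \<open>Orbits of translations\<close>

lemma AE_lborel_shift:
  fixes c :: real
  assumes "AE x in lborel. P x"
  shows "AE x in lborel. P (x + c)"
proof -
  obtain N where N: "\<And>x. x \<notin> N \<Longrightarrow> P x" "N \<in> null_sets lborel"
    using AE_E3[OF assms] by auto
  have "{x. x - (- c) \<in> N} \<in> null_sets lborel"
    by (rule null_sets_translation[OF N(2)])
  then show ?thesis by (rule AE_I') (use N(1) in auto)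
qed

text \<open>The copies \<open>K + t k\<close> have equal measure and lie disjointly in
  \<open>{A + C..B + D}\<close>; infinitely many fit only if that measure is zero.\<close>

lemma null_set_disjoint_bounded_translates:
  fixes K :: "real set" and t :: "nat \<Rightarrow> real"
  assumes K: "K \<in> sets borel" "K \<subseteq> {A..B}" and t: "\<And>k. t k \<in> {C..D}"
    and disj: "\<And>x y j k. j \<noteq> k \<Longrightarrow> x \<in> K \<Longrightarrow> y \<in> K \<Longrightarrow> x + t j \<noteq> y + t k"
  shows "K \<in> null_sets lborel"
proof -
  define S where "S k = {x. x - t k \<in> K}" for k
  have S: "S k \<in> sets lborel" for k
    using K(1) unfolding S_def by measurable
  have eq: "emeasure lborel (S k) = emeasure lborel K" for k
  proof -
    have "emeasure lborel (S k) = emeasure (distr lborel borel ((+) (- t k))) K"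
      by (subst emeasure_distr) (use K in \<open>auto simp: S_def vimage_def\<close>)
    then show ?thesis by (simp only: lborel_distr_plus)
  qed
  have "disjoint_family S"
    unfolding disjoint_family_on_def
  proof (intro ballI impI equals0I)
    fix j k z assume "j \<noteq> k" "z \<in> S j \<inter> S k"
    then show False using disj[of j k "z - t j" "z - t k"] by (auto simp: S_def)
  qed
  then have "(\<Sum>k. emeasure lborel (S k)) = emeasure lborel (\<Union>k. S k)"
    using S by (intro suminf_emeasure) auto
  also have "\<dots> \<le> emeasure lborel {A + C..B + D}"
  proof (rule emeasure_mono)
    show "(\<Union>k. S k) \<subseteq> {A + C..B + D}"
    proof safe
      fix z k assume "z \<in> S k"
      then have "z - t k \<in> {A..B}" "t k \<in> {C..D}" using K(2) t by (auto simp: S_def)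
      then show "z \<in> {A + C..B + D}" by auto
    qed
  qed simp
  also have "\<dots> < \<infinity>" by (simp add: emeasure_lborel_Icc_eq)
  finally have fin: "(\<Sum>k::nat. emeasure lborel K) < \<infinity>" by (simp add: eq)
  have Kfin: "emeasure lborel K < \<infinity>"
    using emeasure_mono[OF K(2), of lborel] by (simp add: emeasure_lborel_Icc_eq le_less_trans)
  then have eqK: "emeasure lborel K = ennreal (measure lborel K)"
    by (intro emeasure_eq_ennreal_measure) simp
  then have "summable (\<lambda>k::nat. measure lborel K)"
    using fin by (intro summable_suminf_not_top) (simp_all only: measure_nonneg, simp)
  then have "measure lborel K = 0" by (simp only: summable_const_iff)
  then show ?thesis using K eqK by (intro null_setsI) simp_all
qed

text \<open>Cutting \<open>K\<close> into pieces of length \<open>\<tau>\<close> and translating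
  each by the residues of \<open>k s\<close> modulo \<open>\<tau>\<close> gives infinitely many
  disjoint copies in a bounded interval.\<close>

lemma null_set_wandering:
  fixes K :: "real set" and s \<tau> :: real
  assumes K: "K \<in> sets borel" and \<tau>: "\<tau> > 0"
    and wander: "\<And>x (k::int) (m::int). x \<in> K \<Longrightarrow> k \<noteq> 0 \<Longrightarrow> x + of_int k * s + of_int m * \<tau> \<notin> K"
  shows "K \<in> null_sets lborel"
proof -
  have part: "K \<inter> {of_int i * \<tau>..of_int (i + 1) * \<tau>} \<in> null_sets lborel" for i :: int
  proof (rule null_set_disjoint_bounded_translates)
    \<comment> \<open>This residue differs from \<open>k s\<close> by a multiple of
      \<open>\<tau>\<close>, which the integer \<open>m\<close> in \<open>wander\<close>
      absorbs.\<close>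
    let ?t = "\<lambda>k::nat. real k * s - of_int \<lfloor>real k * s / \<tau>\<rfloor> * \<tau>"
    show "?t k \<in> {0..\<tau>}" for k
      using floor_divide_lower[OF \<tau>, of "real k * s"] floor_divide_upper[OF \<tau>, of "real k * s"]
      by (auto simp: algebra_simps)
    show "x + ?t j \<noteq> y + ?t k"
      if "j \<noteq> k" "x \<in> K \<inter> {of_int i * \<tau>..of_int (i + 1) * \<tau>}" "y \<in> K \<inter> {of_int i * \<tau>..of_int (i + 1) * \<tau>}"
      for j k x y
    proof
      assume "x + ?t j = y + ?t k"
      then have "y = x + of_int (int j - int k) * s + of_int (\<lfloor>real k * s / \<tau>\<rfloor> - \<lfloor>real j * s / \<tau>\<rfloor>) * \<tau>"
        by (simp add: algebra_simps)
      then show False using wander[of x "int j - int k"] that by (metis IntD1 eq_iff_diff_eq_0 of_nat_eq_iff)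
    qed
  qed (use K in auto)
  have "K \<subseteq> (\<Union>i::int. K \<inter> {of_int i * \<tau>..of_int (i + 1) * \<tau>})"
  proof
    fix x assume "x \<in> K"
    then have "x \<in> K \<inter> {of_int \<lfloor>x / \<tau>\<rfloor> * \<tau>..of_int (\<lfloor>x / \<tau>\<rfloor> + 1) * \<tau>}"
      using floor_divide_lower[OF \<tau>, of x] floor_divide_upper[OF \<tau>, of x] by auto
    then show "x \<in> (\<Union>i::int. K \<inter> {of_int i * \<tau>..of_int (i + 1) * \<tau>})" by blast
  qed
  then have "K = (\<Union>i::int. K \<inter> {of_int i * \<tau>..of_int (i + 1) * \<tau>})"
    by blast
  then show ?thesis using null_sets_UN'[of UNIV "\<lambda>i::int. K \<inter> {of_int i * \<tau>..of_int (i + 1) * \<tau>}" lborel] part by auto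
qed

text \<open>Translates of a window of length \<open>\<bar>s\<bar>\<close> by \<open>n s\<close> are
  disjoint, so the orbit sum integrates over the window to at most the integral of \<open>f\<close>.
  The sum is one-sided; the other half of an orbit comes from \<open>- s\<close>.\<close>

lemma AE_suminf_orbit_finite:
  fixes f :: "real \<Rightarrow> ennreal"
  assumes f[measurable]: "f \<in> borel_measurable borel" and fin: "(\<integral>\<^sup>+x. f x \<partial>lborel) < \<infinity>" and s: "s \<noteq> 0"
  shows "AE x in lborel. (\<Sum>n. f (x + real n * s)) \<noteq> \<infinity>"
proof -
  have part: "AE x in lborel. x \<in> {c..<c + \<bar>s\<bar>} \<longrightarrow> (\<Sum>n. f (x + real n * s)) \<noteq> \<infinity>" for c
  proof -
    let ?J = "{c..<c + \<bar>s\<bar>}"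
    have "(\<integral>\<^sup>+x. (\<Sum>n. f (x + real n * s)) * indicator ?J x \<partial>lborel)
        = (\<integral>\<^sup>+x. (\<Sum>n. f (x + real n * s) * indicator ?J x) \<partial>lborel)"
      by (simp add: ennreal_suminf_multc)
    also have "\<dots> = (\<Sum>n. \<integral>\<^sup>+x. f (x + real n * s) * indicator ?J x \<partial>lborel)"
      by (rule nn_integral_suminf) measurable
    also have "\<dots> = (\<Sum>n. \<integral>\<^sup>+x. f x * indicator ?J (x - real n * s) \<partial>lborel)"
    proof (intro suminf_cong)
      fix n
      show "(\<integral>\<^sup>+x. f (x + real n * s) * indicator ?J x \<partial>lborel) = (\<integral>\<^sup>+x. f x * indicator ?J (x - real n * s) \<partial>lborel)"
        by (subst (2) nn_integral_real_affine[where c = 1 and t = "real n * s"])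
          (simp_all add: add.commute)
    qed
    also have "\<dots> = (\<integral>\<^sup>+x. (\<Sum>n. f x * indicator ?J (x - real n * s)) \<partial>lborel)"
      by (rule nn_integral_suminf[symmetric]) measurable
    also have "\<dots> \<le> (\<integral>\<^sup>+x. f x \<partial>lborel)"
    proof (rule nn_integral_mono)
      fix x
      define A where "A n = {x. x - real n * s \<in> ?J}" for n
      have "disjoint_family A"
        unfolding disjoint_family_on_def
      proof (intro ballI impI equals0I)
        fix j k z assume jk: "j \<noteq> k" and z: "z \<in> A j \<inter> A k"
        have "\<bar>(real j - real k) * s\<bar> < \<bar>s\<bar>"
          using z by (auto simp: A_def algebra_simps abs_if)
        then have "\<bar>real j - real k\<bar> < 1" using s by (simp add: abs_mult)
        then show False using jk by linarith
      qed
      then have "(\<Sum>n. indicator (A n) x) = (indicator (\<Union>n. A n) x :: ennreal)"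
        by (rule suminf_indicator)
      also have "\<dots> \<le> 1" by (simp add: indicator_def)
      finally have "f x * (\<Sum>n. indicator (A n) x) \<le> f x"
        by (metis mult.right_neutral mult_left_mono zero_le)
      moreover have "indicator (A n) x = (indicator ?J (x - real n * s) :: ennreal)" for n
        by (simp add: A_def indicator_def)
      ultimately show "(\<Sum>n. f x * indicator ?J (x - real n * s)) \<le> f x"
        by simp
    qed
    finally have "(\<integral>\<^sup>+x. (\<Sum>n. f (x + real n * s)) * indicator ?J x \<partial>lborel) \<noteq> \<infinity>"
      using fin by (auto simp: top_unique)
    then have "AE x in lborel. (\<Sum>n. f (x + real n * s)) * indicator ?J x \<noteq> \<infinity>"
      by (intro nn_integral_PInf_AE) measurable
    then show ?thesis by eventually_elim (auto simp: indicator_def)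
  qed
  have "AE x in lborel. \<forall>i::int. x \<in> {of_int i * \<bar>s\<bar>..<of_int i * \<bar>s\<bar> + \<bar>s\<bar>} \<longrightarrow> (\<Sum>n. f (x + real n * s)) \<noteq> \<infinity>"
    unfolding AE_all_countable using part by blast
  then show ?thesis
  proof eventually_elim
    case (elim x)
    have "x \<in> {of_int \<lfloor>x / \<bar>s\<bar>\<rfloor> * \<bar>s\<bar>..<of_int \<lfloor>x / \<bar>s\<bar>\<rfloor> * \<bar>s\<bar> + \<bar>s\<bar>}"
      using floor_divide_lower[of "\<bar>s\<bar>" x] floor_divide_upper[of "\<bar>s\<bar>" x] s by (auto simp: algebra_simps)
    then show ?case using elim by blast
  qed
qed

lemma periodic_of_int:
  fixes f :: "real \<Rightarrow> 'a"
  assumes per: "\<And>x. f (x + p) = f x"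
  shows "f (x + of_int m * p) = f x"
proof (induction m rule: int_induct[where k = 0])
  case (step1 i)
  have "x + of_int (i + 1) * p = (x + of_int i * p) + p" by (simp add: algebra_simps)
  then show ?case using step1 by (simp only: per)
next
  case (step2 i)
  have "x + of_int i * p = (x + of_int (i - 1) * p) + p" by (simp add: algebra_simps)
  then show ?case using step2 by (simp only: per)
qed simp

text \<open>Finite level sets make the supremum attained, and only finitely often. Strictness to the
  right but not to the left is the asymmetry on which the uniqueness of peaks rests.\<close>

lemma exists_last_argmax:
  fixes f :: "int \<Rightarrow> real"
  assumes pos: "f k > 0" and fin: "\<And>\<epsilon>. \<epsilon> > 0 \<Longrightarrow> finite {n. \<epsilon> \<le> f n}"
  obtains m where "f m > 0" "\<And>n. n > m \<Longrightarrow> f n < f m" "\<And>n. n < m \<Longrightarrow> f n \<le> f m"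
proof -
  let ?A = "{n. f k \<le> f n}"
  have A: "finite ?A" "?A \<noteq> {}" using fin pos by auto
  define H where "H = Max (f ` ?A)"
  have le: "f n \<le> H" for n
  proof (cases "n \<in> ?A")
    case True
    then show ?thesis using A by (auto simp: H_def)
  next
    case False
    moreover have "f k \<le> H" using A by (auto simp: H_def)
    ultimately show ?thesis by auto
  qed
  have "H \<in> f ` ?A" unfolding H_def using A by (intro Max_in) auto
  then obtain l where l: "f l = H" "f k \<le> H" by auto
  let ?B = "{n. H \<le> f n}"
  have B: "finite ?B" "?B \<noteq> {}" using fin[of H] pos l by auto
  define m where "m = Max ?B"
  have "m \<in> ?B" unfolding m_def using B by (rule Max_in)
  then have m: "f m = H" using le[of m] by simp
  show ?thesis
  proof
    show "f m > 0" using m l pos by simp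
    show "f n < f m" if "n > m" for n
    proof (rule ccontr)
      assume "\<not> f n < f m"
      then have "n \<in> ?B" using m by simp
      then have "n \<le> m" unfolding m_def using B(1) by simp
      then show False using that by simp
    qed
    show "f n \<le> f m" for n using le m by simp
  qed
qed

text \<open>The squares are summable along both half-orbits. Finite level sets are the form in which
  decay at both ends feeds \<open>exists_last_argmax\<close>.\<close>

lemma AE_orbit_level_finite:
  fixes \<phi> :: "real \<Rightarrow> real"
  assumes meas[measurable]: "\<phi> \<in> borel_measurable borel" and nonneg: "\<And>x. \<phi> x \<ge> 0"
    and int: "integrable lborel (\<lambda>x. (\<phi> x)\<^sup>2)" and s: "s \<noteq> 0"
  shows "AE x in lborel. \<forall>\<epsilon>>0. finite {n::int. \<epsilon> \<le> \<phi> (x + of_int n * s)}"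
proof -
  have fin: "(\<integral>\<^sup>+x. ennreal ((\<phi> x)\<^sup>2) \<partial>lborel) < \<infinity>"
    using int by (simp add: integrable_iff_bounded)
  have bound: "\<exists>N. \<forall>n\<ge>N. \<phi> (x + real n * r) < \<epsilon>"
    if "(\<Sum>n. ennreal ((\<phi> (x + real n * r))\<^sup>2)) \<noteq> \<infinity>" "\<epsilon> > 0" for x r \<epsilon>
  proof -
    have "summable (\<lambda>n. (\<phi> (x + real n * r))\<^sup>2)"
      using that(1) by (intro summable_suminf_not_top) simp_all
    then have "(\<lambda>n. (\<phi> (x + real n * r))\<^sup>2) \<longlonglongrightarrow> 0" by (rule summable_LIMSEQ_zero)
    then have "\<forall>\<^sub>F n in sequentially. (\<phi> (x + real n * r))\<^sup>2 < \<epsilon>\<^sup>2"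
      by (rule order_tendstoD) (use that(2) in simp)
    then have "\<forall>\<^sub>F n in sequentially. \<phi> (x + real n * r) < \<epsilon>"
      by eventually_elim (use that(2) in \<open>auto intro: power2_less_imp_less\<close>)
    then show ?thesis by (simp add: eventually_sequentially)
  qed
  have "AE x in lborel. (\<Sum>n. ennreal ((\<phi> (x + real n * s))\<^sup>2)) \<noteq> \<infinity>"
       "AE x in lborel. (\<Sum>n. ennreal ((\<phi> (x + real n * (- s)))\<^sup>2)) \<noteq> \<infinity>"
    using fin s by (intro AE_suminf_orbit_finite[where f = "\<lambda>x. ennreal ((\<phi> x)\<^sup>2)"]; simp)+
  then show ?thesis
  proof eventually_elim
    case (elim x)
    show ?case
    proof (intro allI impI)
      fix \<epsilon> :: real assume "\<epsilon> > 0"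
      then obtain N N' where N: "\<And>n. n \<ge> N \<Longrightarrow> \<phi> (x + real n * s) < \<epsilon>"
          and N': "\<And>n. n \<ge> N' \<Longrightarrow> \<phi> (x + real n * (- s)) < \<epsilon>"
        using bound[OF elim(1)] bound[OF elim(2)] by metis
      have "{n::int. \<epsilon> \<le> \<phi> (x + of_int n * s)} \<subseteq> {- int N'..int N}"
      proof
        fix n :: int assume n: "n \<in> {n. \<epsilon> \<le> \<phi> (x + of_int n * s)}"
        have "n \<le> int N"
        proof (rule ccontr)
          assume "\<not> n \<le> int N"
          then have "N \<le> nat n" "real (nat n) = of_int n" by simp_all
          then show False using N[of "nat n"] n by simp
        qed
        moreover have "- int N' \<le> n"
        proof (rule ccontr)
          assume "\<not> - int N' \<le> n"
          then have "N' \<le> nat (- n)" "real (nat (- n)) = - of_int n" by simp_all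
          then show False using N'[of "nat (- n)"] n by simp
        qed
        ultimately show "n \<in> {- int N'..int N}" by simp
      qed
      then show "finite {n::int. \<epsilon> \<le> \<phi> (x + of_int n * s)}" by (rule finite_subset) simp
    qed
  qed
qed

subsection \<open>Quasi-periodic relations in \<open>L\<^sup>2\<close>\<close>

text \<open>Both \<open>a n * \<alpha> powi n\<close> and \<open>b n * \<beta> powi n\<close> solve
  \<open>X (n + 1) = w n * X n\<close>, which also runs backwards as \<open>w\<close> has no zeros.
  Cross-multiplication allows \<open>a 0\<close> or \<open>b 0\<close> to vanish.\<close>

lemma cocycle_proportional:
  fixes a b :: "int \<Rightarrow> real"
  assumes a: "\<And>n. \<alpha> * a (n + 1) = w n * a n" and b: "\<And>n. \<beta> * b (n + 1) = w n * b n"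
    and nz: "\<alpha> \<noteq> 0" "\<beta> \<noteq> 0" "\<And>n. w n \<noteq> 0"
  shows "a n * \<alpha> powi n * b 0 = b n * \<beta> powi n * a 0"
proof -
  define d where "d n = a n * \<alpha> powi n * b 0 - b n * \<beta> powi n * a 0" for n
  have d: "d (n + 1) = w n * d n" for n
  proof -
    have "d (n + 1) = (\<alpha> * a (n + 1)) * \<alpha> powi n * b 0 - (\<beta> * b (n + 1)) * \<beta> powi n * a 0"
      using nz by (simp add: d_def power_int_add)
    also have "\<dots> = w n * d n" unfolding a b by (simp add: d_def algebra_simps)
    finally show ?thesis .
  qed
  have "d n = 0"
  proof (induction n rule: int_induct[where k = 0])
    case base
    show ?case by (simp add: d_def)
  next
    case (step1 i)
    then show ?case by (simp add: d)
  next
    case (step2 i)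
    then show ?case using d[of "i - 1"] nz by simp
  qed
  then show ?thesis by (simp add: d_def)
qed

text \<open>Decay forces a nonzero orbit to have a peak, while the relation leaves only a null set
  of peaks. Commensurable and incommensurable \<open>s\<close> and \<open>\<tau>\<close> are treated
  alike, so one lemma serves every case of the theorem.\<close>

lemma quasi_periodic_L2_AE_zero:
  fixes \<phi> u w :: "real \<Rightarrow> real"
  assumes [measurable]: "\<phi> \<in> borel_measurable borel" "u \<in> borel_measurable borel"
    and nonneg: "\<And>x. \<phi> x \<ge> 0" and int: "integrable lborel (\<lambda>x. (\<phi> x)\<^sup>2)"
    and s: "s \<noteq> 0" and \<tau>: "\<tau> > 0"
    and u_per: "\<And>x. u (x + s) = u x" and w_per: "\<And>x. w (x + \<tau>) = w x"
    and u_pos: "AE x in lborel. u x > 0" and w_pos: "AE x in lborel. w x > 0"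
    and rel: "AE x in lborel. u x * \<phi> (x + s) = w x * \<phi> x"
  shows "AE x in lborel. \<phi> x = 0"
proof -

  \<comment> \<open>Reduction to orbits avoiding a null set\<close>
  define R where "R x \<longleftrightarrow> (u x > 0 \<and> w x > 0 \<and> u x * \<phi> (x + s) = w x * \<phi> x)
    \<and> (\<forall>\<epsilon>>0. finite {n::int. \<epsilon> \<le> \<phi> (x + of_int n * s)})" for x
  have "AE x in lborel. R x"
    using u_pos w_pos rel AE_orbit_level_finite[OF assms(1) nonneg int s]
    by eventually_elim (simp add: R_def)
  then obtain N where N: "\<And>x. x \<notin> N \<Longrightarrow> R x" "N \<in> null_sets lborel"
    by (rule AE_E3) auto
  have N_meas[measurable]: "N \<in> sets borel" using N(2) by (auto dest: null_setsD2)
  \<comment> \<open>Requiring the whole orbit to avoid \<open>N\<close> makes \<open>G\<close>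
    invariant under shifts by \<open>s\<close>; the Borel set \<open>N\<close> in place of
    \<open>R\<close> makes it measurable.\<close>
  define G where "G x \<longleftrightarrow> (\<forall>k::int. x + of_int k * s \<notin> N)" for x
  have G_shift: "G (x + of_int k * s)" if "G x" for x k
    unfolding G_def
  proof
    fix j :: int
    have "x + of_int (k + j) * s \<notin> N" using that unfolding G_def by blast
    then show "x + of_int k * s + of_int j * s \<notin> N" by (simp add: algebra_simps)
  qed
  have G_R: "R (x + of_int k * s)" if "G x" for x k
    using that N(1) by (auto simp: G_def)
  have u_pos': "u x > 0" if "G x" for x using G_R[OF that, of 0] by (simp add: R_def)
  have u_shift: "u (x + of_int k * s) = u x" for x k by (rule periodic_of_int[of u, OF u_per])
  have w_shift: "w (x + of_int m * \<tau>) = w x" for x m by (rule periodic_of_int[of w, OF w_per])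
  \<comment> \<open>Points congruent modulo \<open>\<tau>\<close> see the same values of
    \<open>w\<close> along their orbits, so their orbit sequences weighted by powers of
    \<open>u\<close> are proportional.\<close>
  have ratio: "\<phi> (x + of_int n * s) * u x powi n * \<phi> y = \<phi> (y + of_int n * s) * u y powi n * \<phi> x"
    if "G x" "G y" "y = x + of_int m * \<tau>" for x y n m
  proof -
    have step: "u z * \<phi> (z + of_int (n + 1) * s) = w (z + of_int n * s) * \<phi> (z + of_int n * s)"
      if "G z" for z n
      using G_R[OF that, of n] u_shift[of z n] by (simp add: R_def algebra_simps)
    have w_eq: "w (y + of_int n * s) = w (x + of_int n * s)" for n
      using w_shift[of "x + of_int n * s" m] that(3) by (simp add: algebra_simps)
    have "w (x + of_int n * s) \<noteq> 0" for n
      using G_R[OF that(1), of n] by (simp add: R_def)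
    then show ?thesis
      using cocycle_proportional[of "u x" "\<lambda>n. \<phi> (x + of_int n * s)" "\<lambda>n. w (x + of_int n * s)"
          "u y" "\<lambda>n. \<phi> (y + of_int n * s)" n]
        step[OF that(1)] step[OF that(2)] u_pos'[OF that(1)] u_pos'[OF that(2)] w_eq
      by simp
  qed

  (* The last argmax over n of f(x + ns) (u(x) / t)^n is n = 0; for t = u x this is a peak of f. *)
  define peak where "peak t x \<longleftrightarrow> \<phi> x > 0
      \<and> (\<forall>n::int. n > 0 \<longrightarrow> \<phi> (x + of_int n * s) * u x powi n < t powi n * \<phi> x)
      \<and> (\<forall>n::int. n < 0 \<longrightarrow> \<phi> (x + of_int n * s) * u x powi n \<le> t powi n * \<phi> x)" for t x
  \<comment> \<open>Multiplying the peak inequality of \<open>x\<close> at \<open>k\<close> by that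
    of \<open>y\<close> at \<open>- k\<close> cancels the powers of \<open>t\<close>; one of the two
    is strict, against the equality that \<open>ratio\<close> gives.\<close>
  have peak_unique: False
    if "t > 0" "G x" "G y" "peak t x" "peak t y" "k \<noteq> 0" "y = x + of_int k * s + of_int m * \<tau>" for t x y k m
  proof -
    let ?z = "x + of_int k * s"
    have "?z + of_int (- k) * s = x" by simp
    then have "\<phi> x * u x powi (- k) * \<phi> y = \<phi> (y + of_int (- k) * s) * u y powi (- k) * \<phi> ?z"
      using ratio[OF G_shift[OF that(2)] that(3,7), of "- k"] u_shift by simp
    then have "u x powi k * (\<phi> x * u x powi (- k) * \<phi> y)
        = u x powi k * (\<phi> (y + of_int (- k) * s) * u y powi (- k) * \<phi> ?z)" by simp
    then have eq: "\<phi> x * \<phi> y = (\<phi> ?z * u x powi k) * (\<phi> (y + of_int (- k) * s) * u y powi (- k))"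
      using u_pos'[OF that(2)] by (simp add: power_int_minus field_simps)
    have pos: "\<phi> x > 0" "\<phi> y > 0" using that by (auto simp: peak_def)
    have nn: "\<phi> ?z * u x powi k \<ge> 0" "\<phi> (y + of_int (- k) * s) * u y powi (- k) \<ge> 0"
      using u_pos'[OF that(2)] u_pos'[OF that(3)] nonneg by (simp_all add: less_imp_le)
    have tt: "(t powi k * \<phi> x) * (t powi (- k) * \<phi> y) = \<phi> x * \<phi> y"
      using that(1) by (simp add: power_int_minus field_simps)
    have gt: "\<phi> ?z * u x powi k > 0" "\<phi> (y + of_int (- k) * s) * u y powi (- k) > 0"
      using mult_pos_pos[OF pos] nn unfolding eq zero_less_mult_iff by (meson not_less)+
    show False
    proof (cases "k > 0")
      case True
      have "\<phi> ?z * u x powi k < t powi k * \<phi> x"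
           "\<phi> (y + of_int (- k) * s) * u y powi (- k) \<le> t powi (- k) * \<phi> y"
        using that(4,5) True unfolding peak_def by (auto simp del: of_int_minus)
      then have "\<phi> x * \<phi> y < (t powi k * \<phi> x) * (t powi (- k) * \<phi> y)"
        unfolding eq by (rule mult_less_le_imp_less[OF _ _ less_imp_le[OF gt(1)] gt(2)])
      then show False using tt by simp
    next
      case False
      then have "k < 0" using that(6) by simp
      have "\<phi> ?z * u x powi k \<le> t powi k * \<phi> x"
           "\<phi> (y + of_int (- k) * s) * u y powi (- k) < t powi (- k) * \<phi> y"
        using that(4,5) \<open>k < 0\<close> unfolding peak_def by (auto simp del: of_int_minus)
      then have "\<phi> x * \<phi> y < (t powi k * \<phi> x) * (t powi (- k) * \<phi> y)"
        unfolding eq by (rule mult_le_less_imp_less[OF _ _ gt(1) less_imp_le[OF gt(2)]])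
      then show False using tt by simp
    qed
  qed

  \<comment> \<open>Null sets of peaks\<close>
  have [measurable]: "(\<lambda>x. u x powi n) \<in> borel_measurable borel" for n
    unfolding power_int_def by measurable
  define K where "K t = {x. G x \<and> peak t x}" for t
  have K_meas[measurable]: "K t \<in> sets borel" for t
    unfolding K_def G_def peak_def by measurable
  have K_null: "K t \<in> null_sets lborel" if "t > 0" for t
    by (rule null_set_wandering[OF K_meas \<tau>, of _ s]) (use peak_unique[OF that] in \<open>auto simp: K_def\<close>)

  \<comment> \<open>Peaks of \<open>\<phi>\<close> itself, without the orbits that meet
    \<open>K t\<close> for some positive rational \<open>t\<close>; these orbits form a null set, as
    only countably many \<open>t\<close> and shifts occur.\<close>
  define L where "L = {x. G x \<and> peak (u x) x \<and> (\<forall>t::rat. t > 0 \<longrightarrow> (\<forall>k::int. x + of_int k * s \<notin> K (of_rat t)))}"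
  have L_meas[measurable]: "L \<in> sets borel"
    unfolding L_def G_def peak_def by measurable
  \<comment> \<open>For a rational \<open>t\<close> strictly between \<open>u x\<close> and
    \<open>u y\<close> the orbit of \<open>x\<close> contains a point of \<open>K t\<close>, which
    \<open>L\<close> excludes.\<close>
  have no_less: False if x: "x \<in> L" and y: "y \<in> L" and xy: "y = x + of_int k * s + of_int m * \<tau>" and less: "u x < u y"
    for x y k m
  proof -
    let ?z = "x + of_int k * s"
    have G: "G x" "G y" "G ?z" using x y G_shift by (auto simp: L_def)
    have ux: "u ?z = u x" by (rule u_shift)
    have pos: "u x > 0" "u y > 0" using G u_pos' by auto
    have \<phi>pos: "\<phi> x > 0" "\<phi> y > 0" using x y by (auto simp: L_def peak_def)
    obtain t :: rat where t: "u x < of_rat t" "of_rat t < u y"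
      using of_rat_dense[OF less] by blast
    define \<theta> :: real where "\<theta> = of_rat t"
    have \<theta>: "u x < \<theta>" "\<theta> < u y" "\<theta> > 0"
      using t pos less_trans[OF pos(1) t(1)] unfolding \<theta>_def by blast+
    have "t > 0" using \<theta>(3) by (simp add: \<theta>_def)
    have rat: "\<phi> (?z + of_int n * s) * u x powi n * \<phi> y = \<phi> (y + of_int n * s) * u y powi n * \<phi> ?z" for n
      using ratio[OF G(3,2) xy, of n] ux by simp
    have "\<phi> x * u x powi (- k) * \<phi> y = \<phi> (y + of_int (- k) * s) * u y powi (- k) * \<phi> ?z"
      using rat[of "- k"] by simp
    then have "\<phi> ?z \<noteq> 0" using \<phi>pos pos by auto
    then have zpos: "\<phi> ?z > 0" using nonneg[of ?z] by simp
    \<comment> \<open>The base \<open>?z\<close> is congruent to \<open>y\<close> modulo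
      \<open>\<tau>\<close>. To the right, \<open>u x < \<theta>\<close> bounds \<open>f\<close> by
      \<open>\<phi>\<close> on the orbit of \<open>?z\<close>; to the left, \<open>rat\<close>
      rewrites \<open>f\<close> through the orbit of \<open>y\<close>, where
      \<open>\<theta> < u y\<close> gives the bound.\<close>
    define f where "f n = \<phi> (?z + of_int n * s) * (u x / \<theta>) powi n" for n
    have f_right: "f n \<le> \<phi> (?z + of_int n * s)" if "n \<ge> 0" for n
    proof -
      have "(u x / \<theta>) powi n \<le> 1" using \<theta> pos that by (simp add: power_int_def power_le_one)
      then show ?thesis unfolding f_def using nonneg by (simp add: mult_left_le)
    qed
    have f_left: "f n \<le> \<phi> (y + of_int n * s) * (\<phi> ?z / \<phi> y)" if "n \<le> 0" for n
    proof -
      have "f n = (\<phi> (?z + of_int n * s) * u x powi n * \<phi> y) / (\<theta> powi n * \<phi> y)"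
        using \<phi>pos by (simp add: f_def power_int_divide_distrib)
      also have "\<dots> = \<phi> (y + of_int n * s) * (\<phi> ?z / \<phi> y) * (u y / \<theta>) powi n"
        by (simp only: rat) (simp add: power_int_divide_distrib mult_ac)
      also have "\<dots> \<le> \<phi> (y + of_int n * s) * (\<phi> ?z / \<phi> y)"
      proof (rule mult_left_le)
        have "(u y / \<theta>) powi n = inverse ((u y / \<theta>) powi (- n))" by (simp add: power_int_minus)
        also have "\<dots> \<le> 1"
          using \<theta> that by (intro inverse_le_1_iff[THEN iffD2] disjI2) (simp add: power_int_def one_le_power)
        finally show "(u y / \<theta>) powi n \<le> 1" .
        show "0 \<le> \<phi> (y + of_int n * s) * (\<phi> ?z / \<phi> y)" using nonneg \<phi>pos by simp
      qed
      finally show ?thesis .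
    qed
    have "finite {n. \<epsilon> \<le> f n}" if "\<epsilon> > 0" for \<epsilon>
    proof (rule finite_subset)
      let ?\<delta> = "\<epsilon> / (\<phi> ?z / \<phi> y)"
      show "{n. \<epsilon> \<le> f n} \<subseteq> {n. \<epsilon> \<le> \<phi> (?z + of_int n * s)} \<union> {n. ?\<delta> \<le> \<phi> (y + of_int n * s)}"
      proof
        fix n assume n: "n \<in> {n. \<epsilon> \<le> f n}"
        show "n \<in> {n. \<epsilon> \<le> \<phi> (?z + of_int n * s)} \<union> {n. ?\<delta> \<le> \<phi> (y + of_int n * s)}"
        proof (cases "n \<ge> 0")
          case True
          then show ?thesis using f_right[OF True] n by simp
        next
          case False
          then have "\<epsilon> \<le> \<phi> (y + of_int n * s) * (\<phi> ?z / \<phi> y)" using f_left[of n] n by simp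
          then have "?\<delta> \<le> \<phi> (y + of_int n * s)" using zpos \<phi>pos by (subst pos_divide_le_eq) auto
          then show ?thesis by simp
        qed
      qed
      have "?\<delta> > 0" using that zpos \<phi>pos by simp
      then show "finite ({n. \<epsilon> \<le> \<phi> (?z + of_int n * s)} \<union> {n. ?\<delta> \<le> \<phi> (y + of_int n * s)})"
        using G_R[OF G(3), of 0] G_R[OF G(2), of 0] that unfolding R_def by simp
    qed
    moreover have "f 0 > 0" using zpos by (simp add: f_def)
    ultimately obtain j where j: "f j > 0" "\<And>n. n > j \<Longrightarrow> f n < f j" "\<And>n. n < j \<Longrightarrow> f n \<le> f j"
      using exists_last_argmax[of f 0] by blast
    let ?p = "x + of_int (k + j) * s"
    have p: "?p = ?z + of_int j * s" by (simp add: algebra_simps)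
    \<comment> \<open>The common positive factor \<open>(\<theta> / u x) powi j\<close> turns
      inequalities between values of \<open>f\<close> into the peak inequalities at
      \<open>?p\<close>.\<close>
    have fj: "f (j + n) * \<theta> powi n * (\<theta> / u x) powi j = \<phi> (?p + of_int n * s) * u x powi n" for n
      using \<theta> pos by (simp add: f_def power_int_add power_int_divide_distrib algebra_simps)
    have fj0: "f j * (\<theta> / u x) powi j = \<phi> ?p"
      using fj[of 0] by simp
    have fj0': "f j * \<theta> powi n * (\<theta> / u x) powi j = \<theta> powi n * \<phi> ?p" for n
      unfolding fj0[symmetric] by (simp only: mult_ac)
    have c: "(\<theta> / u x) powi j > 0" using \<theta> pos by simp
    have "peak \<theta> ?p"
      unfolding peak_def
    proof (intro conjI allI impI)
      show "\<phi> ?p > 0" using j(1) fj0 c by (metis mult_pos_pos)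
      show "\<phi> (?p + of_int n * s) * u ?p powi n < \<theta> powi n * \<phi> ?p" if "n > 0" for n
      proof -
        have "f (j + n) * \<theta> powi n * (\<theta> / u x) powi j < f j * \<theta> powi n * (\<theta> / u x) powi j"
          using j(2)[of "j + n"] that c \<theta> by simp
        then show ?thesis unfolding fj fj0' u_shift .
      qed
      show "\<phi> (?p + of_int n * s) * u ?p powi n \<le> \<theta> powi n * \<phi> ?p" if "n < 0" for n
      proof -
        have "f (j + n) * \<theta> powi n * (\<theta> / u x) powi j \<le> f j * \<theta> powi n * (\<theta> / u x) powi j"
          using j(3)[of "j + n"] that c \<theta> by simp
        then show ?thesis unfolding fj fj0' u_shift .
      qed
    qed
    then have "?p \<in> K (of_rat t)" using G_shift[OF G(1), of "k + j"] unfolding K_def \<theta>_def by blast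
    moreover have "?p \<notin> K (of_rat t)" using x \<open>t > 0\<close> unfolding L_def by blast
    ultimately show False by simp
  qed
  have L_null: "L \<in> null_sets lborel"
  proof (rule null_set_wandering[OF L_meas \<tau>, of s])
    fix x and k m :: int
    assume x: "x \<in> L" and k: "k \<noteq> 0"
    let ?y = "x + of_int k * s + of_int m * \<tau>"
    show "?y \<notin> L"
    proof
      assume y: "?y \<in> L"
      have x_eq: "x = ?y + of_int (- k) * s + of_int (- m) * \<tau>" by simp
      \<comment> \<open>Excluding both strict orders leaves a common value of \<open>u\<close>, so
        \<open>peak_unique\<close> applies with a single \<open>t\<close>.\<close>
      have "u ?y = u x"
        using no_less[OF x y refl] no_less[OF y x x_eq] by (meson linorder_neqE)
      then show False
        using peak_unique[of "u x" x ?y k m] u_pos'[of x] x y k by (auto simp: L_def)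
    qed
  qed

  \<comment> \<open>Almost every orbit misses the exceptional sets\<close>
  have AE_notin: "AE x in lborel. \<forall>k::int. x + of_int k * s \<notin> A" if "A \<in> null_sets lborel" for A
    unfolding AE_all_countable using AE_lborel_shift AE_not_in[OF that] by blast
  have "AE x in lborel. \<forall>t::rat. t > 0 \<longrightarrow> (\<forall>k::int. x + of_int k * s \<notin> K (of_rat t))"
    unfolding AE_all_countable
  proof
    fix t :: rat
    show "AE x in lborel. t > 0 \<longrightarrow> (\<forall>k::int. x + of_int k * s \<notin> K (of_rat t))"
    proof (cases "t > 0")
      case True
      then have "AE x in lborel. \<forall>k::int. x + of_int k * s \<notin> K (of_rat t)"
        by (intro AE_notin K_null) simp
      then show ?thesis by eventually_elim blast
    qed simp
  qed
  with AE_notin[OF N(2)] AE_notin[OF L_null] show ?thesis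
  proof eventually_elim
    case (elim x)
    have G: "G x" using elim(1) by (simp add: G_def)
    show ?case
    proof (rule ccontr)
      assume "\<phi> x \<noteq> 0"
      then have "\<phi> (x + of_int 0 * s) > 0" using nonneg[of x] by simp
      moreover have "finite {n. \<epsilon> \<le> \<phi> (x + of_int n * s)}" if "\<epsilon> > 0" for \<epsilon>
        using G_R[OF G, of 0] that by (simp add: R_def)
      ultimately obtain j where j: "\<phi> (x + of_int j * s) > 0"
          "\<And>n. n > j \<Longrightarrow> \<phi> (x + of_int n * s) < \<phi> (x + of_int j * s)"
          "\<And>n. n < j \<Longrightarrow> \<phi> (x + of_int n * s) \<le> \<phi> (x + of_int j * s)"
        using exists_last_argmax[of "\<lambda>n. \<phi> (x + of_int n * s)" 0] by blast
      let ?p = "x + of_int j * s"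
      have add: "?p + of_int n * s = x + of_int (j + n) * s" for n by (simp add: algebra_simps)
      have "u ?p > 0" using G_shift[OF G] u_pos' by blast
      \<comment> \<open>With \<open>t = u ?p\<close> the powers on both sides agree, so a peak is
        just the last argmax of \<open>\<phi>\<close> on the orbit.\<close>
      then have "peak (u ?p) ?p"
        unfolding peak_def add
        using j(1) j(2)[of "j + _"] j(3)[of "j + _"] by (simp add: mult.commute del: of_int_add)
      then have "?p \<in> L"
        unfolding L_def mem_Collect_eq add using G_shift[OF G] elim(3) by blast
      then show False using elim(2) by blast
    qed
  qed
qed

text \<open>Iterating \<open>n\<close> times replaces the shift \<open>a\<close> by
  \<open>n a\<close>, a period of \<open>p\<close> or of \<open>q\<close>, and products of
  translates keep the periods. For a period of \<open>q\<close> the iterated relation is read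
  backwards.\<close>

lemma two_term_relation_AE_zero:
  fixes \<phi> p q :: "real \<Rightarrow> real"
  assumes [measurable]: "\<phi> \<in> borel_measurable borel" "p \<in> borel_measurable borel" "q \<in> borel_measurable borel"
    and nonneg: "\<And>x. \<phi> x \<ge> 0" and int: "integrable lborel (\<lambda>x. (\<phi> x)\<^sup>2)"
    and per: "\<And>x. p (x + \<alpha>) = p x" "\<And>x. q (x + \<beta>) = q x" and ab: "\<alpha> > 0" "\<beta> > 0"
    and pos: "AE x in lborel. p x > 0" "AE x in lborel. q x > 0"
    and rel: "AE x in lborel. p x * \<phi> x = q x * \<phi> (x - a)"
    and n: "a \<noteq> 0" "n > 0" "real n * a = of_int m * \<alpha> \<or> real n * a = of_int m * \<beta>"
  shows "AE x in lborel. \<phi> x = 0"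
proof -
  define iter :: "(real \<Rightarrow> real) \<Rightarrow> real \<Rightarrow> real"
    \<comment> \<open>The factors start at \<open>x + a\<close> because the relation at
      \<open>x + (j + 1) a\<close> links that point to \<open>x + j a\<close>.\<close>
    where "iter f x = (\<Prod>j<n. f (x + real (Suc j) * a))" for f x
  have iter_meas [measurable]: "iter f \<in> borel_measurable borel" if [measurable]: "f \<in> borel_measurable borel" for f
    unfolding iter_def by measurable
  have iter_per: "iter f (x + c) = iter f x" if "\<And>x. f (x + c) = f x" for f c x
  proof -
    have "f (x + c + real (Suc j) * a) = f (x + real (Suc j) * a)" for j
      using that[of "x + real (Suc j) * a"] by (simp add: add_ac)
    then show ?thesis by (simp add: iter_def)
  qed
  have iter_pos: "AE x in lborel. iter f x > 0" if "AE x in lborel. f x > 0" for f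
  proof -
    have "AE x in lborel. \<forall>j. f (x + real (Suc j) * a) > 0"
      unfolding AE_all_countable using AE_lborel_shift[OF that] by blast
    then show ?thesis by eventually_elim (auto simp: iter_def intro: prod_pos)
  qed
  have iter_rel: "AE x in lborel. iter p x * \<phi> (x + real n * a) = iter q x * \<phi> x"
  proof -
    have "AE x in lborel. \<forall>j. p (x + real (Suc j) * a) * \<phi> (x + real (Suc j) * a)
        = q (x + real (Suc j) * a) * \<phi> (x + real (Suc j) * a - a)"
      unfolding AE_all_countable using AE_lborel_shift[OF rel] by blast
    then show ?thesis
    proof eventually_elim
      case (elim x)
      have "(\<Prod>j<k. p (x + real (Suc j) * a)) * \<phi> (x + real k * a) = (\<Prod>j<k. q (x + real (Suc j) * a)) * \<phi> x" for k
      proof (induction k)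
        case (Suc k)
        have "p (x + real (Suc k) * a) * \<phi> (x + real (Suc k) * a) = q (x + real (Suc k) * a) * \<phi> (x + real k * a)"
          using spec[OF elim, of k] by (simp add: algebra_simps)
        then have "(\<Prod>j<k. p (x + real (Suc j) * a)) * (p (x + real (Suc k) * a) * \<phi> (x + real (Suc k) * a))
            = q (x + real (Suc k) * a) * ((\<Prod>j<k. p (x + real (Suc j) * a)) * \<phi> (x + real k * a))"
          by (simp only: mult_ac)
        then show ?case unfolding Suc.IH by (simp only: prod.lessThan_Suc mult_ac)
      qed simp
      then show ?case by (simp add: iter_def)
    qed
  qed
  show ?thesis
    using n(3)
  proof
    assume na: "real n * a = of_int m * \<alpha>"
    have p_per: "p (x + real n * a) = p x" for x
      unfolding na by (rule periodic_of_int[of p, OF per(1)])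
    show ?thesis
      by (rule quasi_periodic_L2_AE_zero[of \<phi> "iter p" "real n * a" \<beta> "iter q"])
        (use nonneg int n ab iter_per[of p, OF p_per] iter_per[of q, OF per(2)] iter_pos pos iter_rel in simp_all)
  next
    assume na: "real n * a = of_int m * \<beta>"
    \<comment> \<open>Shifting by \<open>- n a\<close> gives \<open>iter q\<close> the role of
      \<open>u\<close>, with period \<open>s\<close>, and the shifted \<open>iter p\<close> the role
      of \<open>w\<close>, with period \<open>\<alpha>\<close>.\<close>
    define s where "s = - (real n * a)"
    have q_per: "q (x + s) = q x" for x
      using periodic_of_int[of q \<beta> x "- m", OF per(2)] na by (simp add: s_def)
    have "AE x in lborel. iter q (x + s) * \<phi> (x + s) = iter p (x + s) * \<phi> x"
      using AE_lborel_shift[OF iter_rel, of s] by eventually_elim (simp add: s_def)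
    moreover have "iter p (x + \<alpha> + s) = iter p (x + s)" for x
      using iter_per[of p, OF per(1), of "x + s"] by (simp add: add_ac)
    ultimately show ?thesis
      using AE_lborel_shift[OF iter_pos[OF pos(1)], of s] iter_pos[OF pos(2)]
        nonneg int n ab iter_per[of q, OF q_per]
      by (intro quasi_periodic_L2_AE_zero[of \<phi> "iter q" s \<alpha> "\<lambda>x. iter p (x + s)"])
        (simp_all add: s_def[symmetric], simp add: s_def)
  qed
qed

subsection \<open>The Gabor system\<close>

theorem theorem3p7:
  fixes g :: "real \<Rightarrow> complex" and a b :: real
  assumes "L2 g" and "L2_norm g = 1" and "b \<noteq> 0"
    and "(a \<in> \<rat> \<and> b \<in> \<rat>)
         \<or> (a \<in> \<rat> \<and> b \<notin> \<rat>)
         \<or> (a \<notin> \<rat> \<and> b \<notin> \<rat> \<and> a * b \<in> \<rat> \<and> (AE x in lborel. Im (g x) = 0))"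
  shows "gabor_lin_indep g {(0,0), (0,1), (0,-1), (a,b), (a,-b)}"
  unfolding gabor_lin_indep_def
proof (intro allI impI)
  fix c :: "real \<times> real \<Rightarrow> complex"
  let ?\<Lambda> = "{(0,0), (0,1), (0,-1), (a,b), (a,-b)}"
  assume dep: "AE x in lborel. (\<Sum>p\<in>?\<Lambda>. c p * gabor_atom g p x) = 0"
  define e :: "real \<Rightarrow> real \<Rightarrow> complex" where "e = (\<lambda>l x. exp (2 * of_real pi * \<i> * of_real l * of_real x))"
  have e_meas [measurable]: "e l \<in> borel_measurable borel" for l
    unfolding e_def by (intro borel_measurable_continuous_onI continuous_intros)
  have e_shift: "e l (x + y) = e l x * e l y" for l x y
    by (simp add: e_def exp_add [symmetric] algebra_simps)
  have e_int: "e l y = 1" if "l * y = of_int m" for l y m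
  proof -
    have "Im (2 * of_real pi * \<i> * of_real l * of_real y) = of_int (2 * m) * pi"
      using that by (simp add: mult_ac)
    then show ?thesis unfolding e_def exp_eq_1 by auto
  qed
  have atom: "gabor_atom g p x = e (snd p) x * g (x - fst p)" for p x
    by (simp add: gabor_atom_def modulation_def translation_def e_def)
  have g_meas [measurable]: "g \<in> borel_measurable borel" and g_int: "integrable lborel (\<lambda>x. (cmod (g x))\<^sup>2)"
    using assms(1) by (simp_all add: L2_def)
  have g_nz: "\<not> (AE x in lborel. g x = 0)"
  proof
    assume "AE x in lborel. g x = 0"
    then have "(LINT x|lborel. (cmod (g x))\<^sup>2) = 0"
      by (intro integral_eq_zero_AE) (auto elim: eventually_mono)
    then show False using assms(2) by (simp add: L2_norm_def)
  qed
  have e_sum_nz: "AE x in lborel. (\<Sum>l\<in>L. d l * e l x) \<noteq> 0" if "finite L" "l \<in> L" "d l \<noteq> 0" for L l d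
    unfolding e_def by (rule AE_exp_sum_nonzero[of L l d, OF that])
  show "\<forall>p\<in>?\<Lambda>. c p = 0"
  proof (rule ccontr)
    assume "\<not> (\<forall>p\<in>?\<Lambda>. c p = 0)"
    then obtain p0 where p0: "p0 \<in> ?\<Lambda>" "c p0 \<noteq> 0" by blast
    show False
    proof (cases "a = 0")
      case True
      let ?L = "{0, 1, -1, b, -b}"
      \<comment> \<open>All atoms are now modulations of \<open>g\<close>. The image form counts
        coinciding frequencies, such as \<open>b = 1\<close>, once on both sides.\<close>
      have \<Lambda>_eq: "?\<Lambda> = Pair 0 ` ?L" using True by auto
      have "(\<Sum>p\<in>Pair 0 ` L. c p * gabor_atom g p x) = (\<Sum>l\<in>L. c (0, l) * e l x) * g x" for L x
        by (simp add: sum.reindex inj_on_def atom sum_distrib_right mult.assoc)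
      then have sum_eq: "(\<Sum>p\<in>?\<Lambda>. c p * gabor_atom g p x) = (\<Sum>l\<in>?L. c (0, l) * e l x) * g x" for x
        unfolding \<Lambda>_eq .
      obtain l0 where "l0 \<in> ?L" "c (0, l0) \<noteq> 0" using p0 True by auto
      then have "AE x in lborel. (\<Sum>l\<in>?L. c (0, l) * e l x) \<noteq> 0"
        by (intro e_sum_nz[of _ l0]) simp_all
      with dep have "AE x in lborel. g x = 0"
        unfolding sum_eq by eventually_elim simp
      then show False using g_nz by simp
    next
      case False
      define P where "P x = (\<Sum>l\<in>{0, 1, -1}. c (0, l) * e l x)" for x
      define Q where "Q x = (\<Sum>l\<in>{b, -b}. c (a, l) * e l x)" for x
      have [measurable]: "P \<in> borel_measurable borel" "Q \<in> borel_measurable borel"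
        unfolding P_def Q_def by measurable
      \<comment> \<open>As \<open>a\<close> and \<open>b\<close> are nonzero, the five points are
        distinct and the sum splits by time shift.\<close>
      have sum_eq: "(\<Sum>p\<in>?\<Lambda>. c p * gabor_atom g p x) = P x * g x + Q x * g (x - a)" for x
        using False assms(3) by (simp add: P_def Q_def atom algebra_simps)
      have rel: "AE x in lborel. P x * g x + Q x * g (x - a) = 0"
        using dep unfolding sum_eq .
      have P_nz: "AE x in lborel. P x \<noteq> 0" if "l \<in> {0, 1, -1}" "c (0, l) \<noteq> 0" for l
        unfolding P_def by (rule e_sum_nz[of _ l]) (use that in auto)
      have Q_nz: "AE x in lborel. Q x \<noteq> 0" if "l \<in> {b, -b}" "c (a, l) \<noteq> 0" for l
        unfolding Q_def by (rule e_sum_nz[of _ l]) (use that in auto)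
      \<comment> \<open>If all coefficients of \<open>P\<close> were zero, \<open>Q\<close> would be
        nonzero almost everywhere and a translate of \<open>g\<close> would vanish.\<close>
      have "\<exists>l\<in>{0, 1, -1}. c (0, l) \<noteq> 0"
      proof (rule ccontr)
        assume contr: "\<not> (\<exists>l\<in>{0, 1, -1}. c (0, l) \<noteq> 0)"
        then have "P x = 0" for x by (simp add: P_def)
        moreover have "AE x in lborel. Q x \<noteq> 0" using contr p0 Q_nz by auto
        ultimately have "AE x in lborel. g (x - a) = 0" using rel by (auto elim: eventually_elim2)
        then have "AE x in lborel. g x = 0" using AE_lborel_shift[of "\<lambda>x. g (x - a) = 0" a] by simp
        then show False using g_nz by simp
      qed
      then have P_nz': "AE x in lborel. P x \<noteq> 0" using P_nz by blast
      have "\<exists>l\<in>{b, -b}. c (a, l) \<noteq> 0"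
      proof (rule ccontr)
        assume "\<not> (\<exists>l\<in>{b, -b}. c (a, l) \<noteq> 0)"
        then have "Q x = 0" for x unfolding Q_def by (intro sum.neutral) auto
        then have "AE x in lborel. g x = 0" using rel P_nz' by (auto elim: eventually_elim2)
        then show False using g_nz by simp
      qed
      then have Q_nz': "AE x in lborel. Q x \<noteq> 0" using Q_nz by blast
      have P_per: "P (x + 1) = P x" for x
        using e_int[of 0 1 0] e_int[of 1 1 1] e_int[of "-1" 1 "-1"] by (simp add: P_def e_shift)
      have Q_per: "Q (x + 1 / \<bar>b\<bar>) = Q x" for x
        using e_int[of b "1 / \<bar>b\<bar>" "if b > 0 then 1 else -1"] e_int[of "-b" "1 / \<bar>b\<bar>" "if b > 0 then -1 else 1"] assms(3)
        by (simp add: Q_def e_shift abs_if split: if_splits)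
      \<comment> \<open>Cases (i) and (ii) give a multiple of the period 1 of \<open>P\<close>, case
        (iii) a multiple of the period \<open>1 / \<bar>b\<bar>\<close> of \<open>Q\<close>;
        \<open>n\<close> is the denominator of \<open>a\<close> or of
        \<open>a * \<bar>b\<bar>\<close>.\<close>
      obtain n :: nat and m :: int where nm: "n > 0" "real n * a = of_int m * 1 \<or> real n * a = of_int m * (1 / \<bar>b\<bar>)"
      proof -
        consider "a \<in> \<rat>" | "a * \<bar>b\<bar> \<in> \<rat>" using assms(4) by (auto simp: abs_if)
        then show ?thesis
        proof cases
          case 1
          then obtain m n where "n \<noteq> 0" "a = of_int m / of_nat n" unfolding Rats_eq_int_div_nat by blast
          then show ?thesis by (intro that[of n m]) auto
        next
          case 2
          then obtain m n where "n \<noteq> 0" "a * \<bar>b\<bar> = of_int m / of_nat n" unfolding Rats_eq_int_div_nat by blast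
          then show ?thesis using assms(3) by (intro that[of n m]) (auto simp: field_simps)
        qed
      qed
      \<comment> \<open>Absolute values discard the phases and leave nonnegative functions, for
        which maxima along orbits make sense.\<close>
      have "AE x in lborel. cmod (P x) * cmod (g x) = cmod (Q x) * cmod (g (x - a))"
        using rel
      proof eventually_elim
        case (elim x)
        then have "P x * g x = - (Q x * g (x - a))" by (simp add: eq_neg_iff_add_eq_0)
        then show ?case by (metis norm_minus_cancel norm_mult)
      qed
      then have "AE x in lborel. cmod (g x) = 0"
        using P_nz' Q_nz' P_per Q_per False assms(3) nm g_int
        by (intro two_term_relation_AE_zero[of "\<lambda>x. cmod (g x)" "\<lambda>x. cmod (P x)" "\<lambda>x. cmod (Q x)" 1 "1 / \<bar>b\<bar>" a n m])
          simp_all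
      then show False using g_nz by simp
    qed
  qed
qed

end
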